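(* Let $G$ be a connected graph with $n(G)\geq 2$ and let $H$ be a graph. Then $o(G\odot H)=\mathcal{D}$ if $o(H)\in\{\mathcal{D},\mathcal{N}\}$, and $o(G\odot H)=\mathcal{S}$ if $o(H)=\mathcal{S}$.
   Context: All graphs are finite and simple; $n(G)$ denotes the order of $G$. The Maker-Breaker domination (MBD) game on a graph $G$: two players, Dominator and Staller, alternately select a not yet selected vertex of $G$. Dominator wins if the set of vertices he selected contains a dominating set of $G$; Staller wins if she selects at least one vertex from every dominating set of $G$. In the D-game Dominator moves first, in the S-game Staller moves first. The outcome $o(G)$ is $\mathcal{D}$ if Dominator has a winning strategy in both the D-game and the S-game, $\mathcal{S}$ if Staller has a winning strategy in both, and $\mathcal{N}$ if the player who moves first has a winning strategy. The corona $G\odot H$ is obtained from one copy of $G$ and $n(G)$ disjoint copies of $H$ by joining the $i$-th vertex of $G$ to every vertex of the $i$-th copy of $H$. *)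

theory Defs
  imports "Graph_Theory.Graph_Theory"
begin

text \<open>
  Finite simple graphs are modelled by the library locale \<^locale>\<open>pair_graph\<close>: finitely many vertices,
  no loops, and a symmetric arc relation, so that an edge \<open>uv\<close> is the pair of arcs \<open>(u, v)\<close>, \<open>(v, u)\<close>.
\<close>

definition corona :: "'a pair_pre_digraph \<Rightarrow> 'b pair_pre_digraph \<Rightarrow> ('a + 'a \<times> 'b) pair_pre_digraph"
    (infixl \<open>\<odot>\<close> 70) where
  "G \<odot> H =
    \<lparr> pverts = Inl ` pverts G \<union> Inr ` (pverts G \<times> pverts H),
      parcs = {(Inl u, Inl v) | u v. (u, v) \<in> parcs G}
        \<union> {(Inr (g, x), Inr (g, y)) | g x y. g \<in> pverts G \<and> (x, y) \<in> parcs H}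
        \<union> {(Inl g, Inr (g, x)) | g x. g \<in> pverts G \<and> x \<in> pverts H}
        \<union> {(Inr (g, x), Inl g) | g x. g \<in> pverts G \<and> x \<in> pverts H} \<rparr>"

definition dominating_set :: "'a pair_pre_digraph \<Rightarrow> 'a set \<Rightarrow> bool" where
  "dominating_set G D \<longleftrightarrow>
    D \<subseteq> pverts G \<and> (\<forall>v \<in> pverts G - D. \<exists>u \<in> D. (u, v) \<in> parcs G)"


section \<open>The Maker-Breaker domination game\<close>

datatype player = Dominator | Staller

fun opponent :: "player \<Rightarrow> player" where
  "opponent Dominator = Staller"
| "opponent Staller = Dominator"

text \<open>
  A history is the list of the vertices selected so far, in order. The parameter \<open>f\<close> below is the player
  who moves first: \<^const>\<open>Dominator\<close> gives the D-game, \<^const>\<open>Staller\<close> the S-game.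
\<close>

definition mover :: "player \<Rightarrow> nat \<Rightarrow> player" where
  "mover f i = (if even i then f else opponent f)"

definition history :: "'a pair_pre_digraph \<Rightarrow> 'a list \<Rightarrow> bool" where
  "history G h \<longleftrightarrow> distinct h \<and> set h \<subseteq> pverts G"

definition selected :: "player \<Rightarrow> player \<Rightarrow> 'a list \<Rightarrow> 'a set" where
  "selected f p h = {h ! i | i. i < length h \<and> mover f i = p}"

fun wins :: "'a pair_pre_digraph \<Rightarrow> player \<Rightarrow> player \<Rightarrow> 'a list \<Rightarrow> bool" where
  "wins G f Dominator h \<longleftrightarrow> (\<exists>D. dominating_set G D \<and> D \<subseteq> selected f Dominator h)"
| "wins G f Staller h \<longleftrightarrow> (\<forall>D. dominating_set G D \<longrightarrow> D \<inter> selected f Staller h \<noteq> {})"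

definition strategy :: "'a pair_pre_digraph \<Rightarrow> player \<Rightarrow> player \<Rightarrow> ('a list \<Rightarrow> 'a) \<Rightarrow> bool" where
  "strategy G f p \<sigma> \<longleftrightarrow>
    (\<forall>h. history G h \<and> set h \<noteq> pverts G \<and> mover f (length h) = p \<longrightarrow> \<sigma> h \<in> pverts G - set h)"

definition follows :: "player \<Rightarrow> player \<Rightarrow> ('a list \<Rightarrow> 'a) \<Rightarrow> 'a list \<Rightarrow> bool" where
  "follows f p \<sigma> h \<longleftrightarrow> (\<forall>i < length h. mover f i = p \<longrightarrow> h ! i = \<sigma> (take i h))"

text \<open>
  Plays are evaluated when every vertex has been selected. Both winning conditions persist when further
  vertices are selected, so stopping a play as soon as it is decided would make no difference.
\<close>

definition has_winning_strategy :: "'a pair_pre_digraph \<Rightarrow> player \<Rightarrow> player \<Rightarrow> bool" where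
  "has_winning_strategy G f p \<longleftrightarrow>
    (\<exists>\<sigma>. strategy G f p \<sigma> \<and>
      (\<forall>h. history G h \<and> set h = pverts G \<and> follows f p \<sigma> h \<longrightarrow> wins G f p h))"

datatype outcome = Outcome_D (\<open>\<D>\<close>) | Outcome_S (\<open>\<S>\<close>) | Outcome_N (\<open>\<N>\<close>)

text \<open>
  \<open>has_outcome G x\<close> renders \<open>o(G) = x\<close>; by \<open>has_outcome_unique\<close> below, \<open>x\<close> is determined by \<open>G\<close>.
\<close>

fun has_outcome :: "'a pair_pre_digraph \<Rightarrow> outcome \<Rightarrow> bool" where
  "has_outcome G \<D> \<longleftrightarrow> (\<forall>f. has_winning_strategy G f Dominator)"
| "has_outcome G \<S> \<longleftrightarrow> (\<forall>f. has_winning_strategy G f Staller)"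
| "has_outcome G \<N> \<longleftrightarrow> (\<forall>f. has_winning_strategy G f f)"

lemma not_both_winning:
  assumes fin: "finite (pverts G)"
    and D: "has_winning_strategy G f Dominator" and S: "has_winning_strategy G f Staller"
  shows False
proof -
  obtain \<sigma> where \<sigma>: "strategy G f Dominator \<sigma>"
      "\<And>h. history G h \<Longrightarrow> set h = pverts G \<Longrightarrow> follows f Dominator \<sigma> h \<Longrightarrow> wins G f Dominator h"
    using D unfolding has_winning_strategy_def by blast
  obtain \<tau> where \<tau>: "strategy G f Staller \<tau>"
      "\<And>h. history G h \<Longrightarrow> set h = pverts G \<Longrightarrow> follows f Staller \<tau> h \<Longrightarrow> wins G f Staller h"
    using S unfolding has_winning_strategy_def by blast
  have "\<exists>h. history G h \<and> length h = n \<and> follows f Dominator \<sigma> h \<and> follows f Staller \<tau> h"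
    if "n \<le> card (pverts G)" for n
    using that
  proof (induction n)
    case 0
    show ?case by (simp add: history_def follows_def)
  next
    case (Suc n)
    then obtain h where h: "history G h" "length h = n"
        "follows f Dominator \<sigma> h" "follows f Staller \<tau> h"
      by auto
    have "set h \<noteq> pverts G"
      using h Suc.prems by (metis distinct_card history_def not_less_eq_eq order_refl)
    define v where "v = (if mover f n = Dominator then \<sigma> h else \<tau> h)"
    have "mover f n = Dominator \<or> mover f n = Staller"
      by (metis player.exhaust)
    then have v: "v \<in> pverts G - set h"
      using \<sigma>(1) \<tau>(1) h \<open>set h \<noteq> pverts G\<close> unfolding strategy_def v_def by auto
    have "history G (h @ [v])"
      using h(1) v by (auto simp: history_def)
    moreover have "follows f Dominator \<sigma> (h @ [v])" "follows f Staller \<tau> (h @ [v])"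
      using h(2-4) unfolding follows_def
      by (auto simp: v_def nth_append less_Suc_eq)
    ultimately show ?case
      using h(2) by (metis length_append_singleton)
  qed
  then obtain h where h: "history G h" "length h = card (pverts G)"
      "follows f Dominator \<sigma> h" "follows f Staller \<tau> h"
    by blast
  then have "set h = pverts G"
    using fin by (metis card_subset_eq distinct_card history_def)
  then have "wins G f Dominator h" "wins G f Staller h"
    using h \<sigma>(2) \<tau>(2) by blast+
  then obtain x where "x \<in> selected f Dominator h" "x \<in> selected f Staller h"
    by fastforce
  then show False
    using h(1) by (auto simp: selected_def history_def nth_eq_iff_index_eq)
qed

lemma has_outcome_unique:
  assumes "finite (pverts G)" "has_outcome G x" "has_outcome G y"
  shows "x = y"
  using assms not_both_winning[OF assms(1)]
  by (cases x; cases y) (simp_all, blast+)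

end

(* The winning condition of a player depends monotonically on the set of vertices that player owns, so
   the game can be analysed on positions (free vertices, owned vertices), where an additional vertex or
   an additional move never hurts. In the corona, Dominator treats every vertex g of G together with its
   copy of H separately: if Staller selects a vertex of the copy, then Dominator answers with g, which
   dominates the whole copy; if Staller selects g, then Dominator starts a won D-game on the copy.
   Staller, on the other hand, selects a vertex g whose copy is untouched (one exists since G has two
   vertices) and then wins as the second player on that copy: a dominating set that avoids g
   restricts to a dominating set of the copy. *)
theory Submission
  imports Defs
begin

section \<open>Games on positions\<close>

text \<open>The flag tells whether the player who aims at \<open>W\<close> is to move; \<open>F\<close> is the set of free vertices
  and \<open>A\<close> the set of vertices owned by that player.\<close>

inductive secures :: "('a set \<Rightarrow> bool) \<Rightarrow> bool \<Rightarrow> 'a set \<Rightarrow> 'a set \<Rightarrow> bool" for W where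
  finished: "W A \<Longrightarrow> secures W b {} A"
| own_move: "x \<in> F \<Longrightarrow> secures W False (F - {x}) (insert x A) \<Longrightarrow> secures W True F A"
| other_move: "F \<noteq> {} \<Longrightarrow> (\<And>x. x \<in> F \<Longrightarrow> secures W True (F - {x}) A) \<Longrightarrow> secures W False F A"

lemma secures_empty [simp]: "secures W b {} A \<longleftrightarrow> W A"
  by (subst secures.simps) auto

lemma secures_True_iff:
  "F \<noteq> {} \<Longrightarrow> secures W True F A \<longleftrightarrow> (\<exists>x\<in>F. secures W False (F - {x}) (insert x A))"
  by (subst secures.simps) auto

lemma secures_FalseD:
  "secures W False F A \<Longrightarrow> x \<in> F \<Longrightarrow> secures W True (F - {x}) A"
  by (erule secures.cases) auto

text \<open>The two claims need a joint induction: an extra vertex may be the very one that the strategy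
  selects next, and then an arbitrary other move has to be made instead.\<close>

lemma secures_extra:
  assumes "mono W" and "finite F"
  shows secures_extra_vertex:
      "x \<in> F \<Longrightarrow> secures W b F A \<Longrightarrow> secures W b (F - {x}) (insert x A)"
    and secures_extra_move: "secures W False F A \<Longrightarrow> secures W True F A"
proof -
  have "(\<forall>b A. \<forall>x\<in>F. secures W b F A \<longrightarrow> secures W b (F - {x}) (insert x A))
      \<and> (\<forall>A. secures W False F A \<longrightarrow> secures W True F A)"
    using \<open>finite F\<close>
  proof (induction F rule: finite_psubset_induct)
    case (psubset F)
    have vertex: "secures W b (F - {x}) (insert x A)" if x: "x \<in> F" and s: "secures W b F A" for b A x
    \<comment> \<open>If \<open>x\<close> is the only free vertex, selecting it ends the game, so
      \<open>other_move\<close> cannot apply and monotonicity of \<open>W\<close> decides.\<close>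
    proof (cases "F = {x}")
      case True
      have "W A \<Longrightarrow> W (insert x A)"
        using \<open>mono W\<close> by (auto dest: monoD[of W A "insert x A"])
      then show ?thesis
        using s True secures_FalseD[of W F A x] by (cases b) (auto simp: secures_True_iff)
    next
      case False
      then have ne: "F - {x} \<noteq> {}" using x by blast
      show ?thesis
      proof (cases b)
        case True
        moreover have "F \<noteq> {}" using x by blast
        ultimately obtain y where y: "y \<in> F" "secures W False (F - {y}) (insert y A)"
          using s by (auto simp: secures_True_iff)
        show ?thesis
        proof (cases "y = x")
          case True
          then show ?thesis using psubset.IH[of "F - {x}"] y x \<open>b\<close> by auto
        next
          case False
          then have "secures W False (F - {y} - {x}) (insert x (insert y A))"
            using psubset.IH[of "F - {y}"] y x by auto
          then have "secures W False (F - {x} - {y}) (insert y (insert x A))"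
            by (simp add: insert_commute Diff_insert2[symmetric])
          then show ?thesis using y False \<open>b\<close> by (auto intro: own_move)
        qed
      next
        case b: False
        have "secures W True (F - {x} - {y}) (insert x A)" if y: "y \<in> F - {x}" for y
        proof -
          have "secures W True (F - {y}) A"
            using s b y secures_FalseD by auto
          then have "secures W True (F - {y} - {x}) (insert x A)"
            using psubset.IH[of "F - {y}"] y x by auto
          then show ?thesis by (simp add: insert_commute Diff_insert2[symmetric])
        qed
        with ne have "secures W False (F - {x}) (insert x A)" by (rule other_move)
        with b show ?thesis by simp
      qed
    qed
    \<comment> \<open>The additional move is spent on any free vertex, which by
      \<open>vertex\<close> does no harm.\<close>
    have "secures W True F A" if "secures W False F A" for A
      using that vertex by (cases "F = {}") (auto intro: own_move)
    with vertex show ?case by blast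
  qed
  then show "x \<in> F \<Longrightarrow> secures W b F A \<Longrightarrow> secures W b (F - {x}) (insert x A)"
    and "secures W False F A \<Longrightarrow> secures W True F A"
    by blast+
qed

text \<open>The form matches the \<open>reply\<close> premise of
  \<open>secures_by_invariant\<close>. The first disjunct covers an opponent who took the last free
  vertex, so that no answer is possible.\<close>

lemma secures_reply:
  assumes "secures W False F A" and "x \<in> F"
  shows "secures W False (F - {x}) A \<or> (\<exists>y\<in>F - {x}. secures W False (F - {x} - {y}) (insert y A))"
proof -
  have s: "secures W True (F - {x}) A"
    using assms by (rule secures_FalseD)
  show ?thesis
  proof (cases "F - {x} = {}")
    case True
    show ?thesis using s unfolding True by simp
  next
    case False
    then show ?thesis using s by (simp add: secures_True_iff)
  qed
qed

text \<open>Principle for combining local strategies; \<open>I\<close> describes positions with the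
  opponent to move. If \<open>reply\<close> only offers a pass, the player must still move, and
  \<open>extra\<close> makes any free vertex a harmless choice.\<close>

lemma secures_by_invariant:
  assumes "finite F" and "I F A"
    and final: "\<And>A. I {} A \<Longrightarrow> W A"
    and extra: "\<And>F A x. finite F \<Longrightarrow> x \<in> F \<Longrightarrow> I F A \<Longrightarrow> I (F - {x}) (insert x A)"
    and reply: "\<And>F A x. finite F \<Longrightarrow> x \<in> F \<Longrightarrow> I F A \<Longrightarrow>
      I (F - {x}) A \<or> (\<exists>y\<in>F - {x}. I (F - {x} - {y}) (insert y A))"
  shows "secures W b F A"
proof -
  have "secures W False F A" if "finite F" "I F A" for F A
    using that
  proof (induction F arbitrary: A rule: finite_psubset_induct)
    case (psubset F)
    have "secures W True (F - {x}) A" if x: "x \<in> F" for x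
    proof (cases "F - {x} = {}")
      case True
      \<comment> \<open>No vertex is left for an answer, so \<open>reply\<close> must give its first
        disjunct.\<close>
      show ?thesis using reply[OF psubset.hyps x psubset.prems] final unfolding True by simp
    next
      case False
      then obtain y where y: "y \<in> F - {x}" "I (F - {x} - {y}) (insert y A)"
        using reply[OF psubset.hyps x psubset.prems] extra[of "F - {x}" _ A] psubset.hyps by blast
      moreover have "F - {x} - {y} \<subset> F" using x by blast
      ultimately show ?thesis using psubset.IH by (blast intro: own_move)
    qed
    then show ?case
      using final psubset.prems by (cases "F = {}") (auto intro: other_move)
  qed
  \<comment> \<open>When the player opens the game, any first vertex will do.\<close>
  moreover have "\<exists>x\<in>F. I (F - {x}) (insert x A)" if "F \<noteq> {}"
    using that extra \<open>finite F\<close> \<open>I F A\<close> by blast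
  ultimately show ?thesis
    using assms(1,2) final
    by (cases "F = {}"; cases b) (simp_all, meson own_move finite_Diff)
qed


section \<open>Winning strategies and positions\<close>

fun winning_set :: "'a pair_pre_digraph \<Rightarrow> player \<Rightarrow> 'a set \<Rightarrow> bool" where
  "winning_set G Dominator A \<longleftrightarrow> (\<exists>D. dominating_set G D \<and> D \<subseteq> A)"
| "winning_set G Staller A \<longleftrightarrow> (\<forall>D. dominating_set G D \<longrightarrow> D \<inter> A \<noteq> {})"

lemma mono_winning_set: "mono (winning_set G p)"
proof (rule monoI, rule le_boolI)
  fix A B
  assume "A \<subseteq> B" and "winning_set G p A"
  then show "winning_set G p B" by (cases p) (simp, blast)+
qed

lemma wins_iff_winning_set: "wins G f p h \<longleftrightarrow> winning_set G p (selected f p h)"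
  by (cases p) simp_all

lemma selected_Nil [simp]: "selected f p [] = {}"
  by (simp add: selected_def)

lemma selected_snoc:
  "selected f p (h @ [v]) =
    (if mover f (length h) = p then insert v (selected f p h) else selected f p h)"
proof -
  let ?I = "{i. i < length h \<and> mover f i = p}"
  have image: "selected f p h' = (!) h' ` {i. i < length h' \<and> mover f i = p}" for h'
    by (auto simp: selected_def)
  have "{i. i < length (h @ [v]) \<and> mover f i = p} =
      (if mover f (length h) = p then insert (length h) ?I else ?I)"
    by (auto simp: less_Suc_eq)
  moreover have "(!) (h @ [v]) ` ?I = (!) h ` ?I"
    by (intro image_cong) (auto simp: nth_append)
  ultimately show ?thesis
    unfolding image by simp
qed

lemma follows_snoc:
  "follows f p \<sigma> (h @ [v]) \<longleftrightarrow> follows f p \<sigma> h \<and> (mover f (length h) = p \<longrightarrow> v = \<sigma> h)"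
  by (auto simp: follows_def nth_append less_Suc_eq)

lemma history_snoc: "history G (h @ [v]) \<longleftrightarrow> history G h \<and> v \<in> pverts G - set h"
  by (auto simp: history_def)

lemma mover_Suc: "mover f (Suc n) = p \<longleftrightarrow> mover f n \<noteq> p"
  by (cases f; cases p) (auto simp: mover_def)

text \<open>Backward induction over the free vertices: \<open>\<sigma>\<close> may depend on the
  order of play, but every history following it leads to a secured position, because its completions
  are won.\<close>

lemma strategy_imp_secures:
  assumes "finite (pverts G)" and \<sigma>: "strategy G f p \<sigma>"
    and win: "\<And>h. history G h \<Longrightarrow> set h = pverts G \<Longrightarrow> follows f p \<sigma> h \<Longrightarrow> wins G f p h"
    and "history G h" and "follows f p \<sigma> h"
  shows "secures (winning_set G p) (mover f (length h) = p) (pverts G - set h) (selected f p h)"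
  using assms(4,5)
proof (induction "card (pverts G - set h)" arbitrary: h rule: less_induct)
  case less
  have step: "secures (winning_set G p) (mover f (length h) \<noteq> p)
      (pverts G - set h - {v}) (selected f p (h @ [v]))"
    if v: "v \<in> pverts G - set h" and f: "follows f p \<sigma> (h @ [v])" for v
  proof -
    have "card (pverts G - set (h @ [v])) < card (pverts G - set h)"
      using v \<open>finite (pverts G)\<close> by (intro psubset_card_mono) auto
    moreover have "pverts G - set (h @ [v]) = pverts G - set h - {v}"
      by auto
    ultimately show ?thesis
      using less.hyps[of "h @ [v]"] less.prems v f by (simp add: history_snoc mover_Suc)
  qed
  show ?case
  proof (cases "set h = pverts G")
    case True
    then show ?thesis using win less.prems by (simp add: wins_iff_winning_set)
  next
    case False
    show ?thesis
    proof (cases "mover f (length h) = p")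
      case True
      then have "\<sigma> h \<in> pverts G - set h"
        using False \<sigma> less.prems by (simp add: strategy_def)
      then show ?thesis
        using step[of "\<sigma> h"] True less.prems by (auto simp: follows_snoc selected_snoc intro: own_move)
    next
      case other: False
      have "pverts G - set h \<noteq> {}"
        using False less.prems by (auto simp: history_def)
      then show ?thesis
        using step other less.prems by (auto simp: follows_snoc selected_snoc intro!: other_move)
    qed
  qed
qed

text \<open>Always moving to a secured position is a strategy, and a secured position without free
  vertices is won.\<close>

lemma secures_imp_has_winning_strategy:
  assumes start: "secures (winning_set G p) (f = p) (pverts G) {}"
  shows "has_winning_strategy G f p"
proof -
  define good where "good h x \<longleftrightarrow> x \<in> pverts G - set h \<and>
    secures (winning_set G p) False (pverts G - set h - {x}) (insert x (selected f p h))" for h x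
  \<comment> \<open>\<open>strategy\<close> demands a legal move at every history, also at those
    never reached under \<open>\<sigma>\<close>; where no good move exists, any free vertex serves
    as default.\<close>
  define \<sigma> where "\<sigma> h = (if \<exists>x. good h x then SOME x. good h x else SOME x. x \<in> pverts G - set h)" for h
  have good: "good h (\<sigma> h)" if "good h x" for h x
    using that someI[of "good h" x] by (auto simp: \<sigma>_def)
  have strat: "strategy G f p \<sigma>"
    unfolding strategy_def
  proof (intro allI impI)
    fix h
    assume "history G h \<and> set h \<noteq> pverts G \<and> mover f (length h) = p"
    then obtain x where "x \<in> pverts G - set h"
      by (auto simp: history_def)
    then have "(SOME x. x \<in> pverts G - set h) \<in> pverts G - set h"
      by (rule someI)
    then show "\<sigma> h \<in> pverts G - set h"
    proof (cases "\<exists>x. good h x")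
      case True
      then have "good h (\<sigma> h)" using good by blast
      then show ?thesis by (simp add: good_def)
    qed (simp add: \<sigma>_def)
  qed
  have secured: "secures (winning_set G p) (mover f (length h) = p) (pverts G - set h) (selected f p h)"
    if "history G h" "follows f p \<sigma> h" for h
    using that
  proof (induction h rule: rev_induct)
    case Nil
    then show ?case using start by (simp add: mover_def)
  next
    case (snoc v h)
    then have IH: "secures (winning_set G p) (mover f (length h) = p) (pverts G - set h) (selected f p h)"
      and v: "v \<in> pverts G - set h" and \<sigma>: "mover f (length h) = p \<Longrightarrow> v = \<sigma> h"
      by (auto simp: follows_snoc history_snoc)
    have free: "pverts G - set (h @ [v]) = pverts G - set h - {v}"
      by auto
    show ?case
    proof (cases "mover f (length h) = p")
      case True
      have "pverts G - set h \<noteq> {}" using v by blast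
      then obtain x where "good h x"
        using IH True by (auto simp: secures_True_iff good_def)
      then have "good h v" using good \<sigma> True by simp
      then show ?thesis unfolding free using True by (simp add: good_def selected_snoc mover_Suc)
    next
      case False
      then show ?thesis
        unfolding free using IH v by (simp add: secures_FalseD selected_snoc mover_Suc)
    qed
  qed
  have "wins G f p h" if "history G h" "set h = pverts G" "follows f p \<sigma> h" for h
    using secured[of h] that by (simp add: wins_iff_winning_set)
  with strat show ?thesis
    unfolding has_winning_strategy_def by blast
qed

lemma has_winning_strategy_iff_secures:
  assumes "finite (pverts G)"
  shows "has_winning_strategy G f p \<longleftrightarrow> secures (winning_set G p) (f = p) (pverts G) {}"
proof
  assume "has_winning_strategy G f p"
  then obtain \<sigma> where "strategy G f p \<sigma>"
      "\<And>h. history G h \<Longrightarrow> set h = pverts G \<Longrightarrow> follows f p \<sigma> h \<Longrightarrow> wins G f p h"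
    unfolding has_winning_strategy_def by blast
  from strategy_imp_secures[OF assms this, of "[]"]
  show "secures (winning_set G p) (f = p) (pverts G) {}"
    by (simp add: history_def follows_def mover_def)
qed (rule secures_imp_has_winning_strategy)


section \<open>The corona\<close>

definition copy :: "'a \<Rightarrow> ('a + 'a \<times> 'b) set \<Rightarrow> 'b set" where
  "copy g X = {x. Inr (g, x) \<in> X}"

lemma copy_insert_Inl [simp]: "copy g (insert (Inl u) X) = copy g X"
  and copy_insert_Inr [simp]:
    "copy g (insert (Inr (u, x)) X) = (if u = g then insert x (copy g X) else copy g X)"
  and copy_Diff_Inl [simp]: "copy g (X - {Inl u}) = copy g X"
  and copy_Diff_Inr [simp]:
    "copy g (X - {Inr (u, x)}) = (if u = g then copy g X - {x} else copy g X)"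
  and copy_empty [simp]: "copy g {} = {}"
  by (auto simp: copy_def)

lemma mem_copy [simp]: "x \<in> copy g X \<longleftrightarrow> Inr (g, x) \<in> X"
  by (simp add: copy_def)

lemma finite_copy: "finite X \<Longrightarrow> finite (copy g X)"
  unfolding copy_def by (rule finite_vimageI[of X "\<lambda>x. Inr (g, x)", unfolded vimage_def]) (auto intro: injI)

text \<open>The new vertex either lies in the copy, where it is an extra vertex, or leaves the
  restricted position unchanged.\<close>

lemma secures_copy_extra:
  assumes "mono W" and "finite F" and "x \<in> F" and s: "secures W b (copy g F) (copy g A)"
  shows "secures W b (copy g (F - {x})) (copy g (insert x A))"
proof (cases "\<exists>z. x = Inr (g, z)")
  case True
  then obtain z where z: "x = Inr (g, z)" by blast
  then have "z \<in> copy g F" using \<open>x \<in> F\<close> by simp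
  from secures_extra_vertex[OF \<open>mono W\<close> finite_copy[OF \<open>finite F\<close>] this s] show ?thesis
    using z by simp
next
  case False
  then have "copy g (F - {x}) = copy g F" "copy g (insert x A) = copy g A" by auto
  with s show ?thesis by simp
qed

text \<open>An opponent's move inside the copy is answered there; a move outside does not affect it,
  so the first disjunct then acts as a pass.\<close>

lemma secures_copy_reply:
  assumes "x \<in> F" and s: "secures W False (copy g F) (copy g A)"
  shows "secures W False (copy g (F - {x})) (copy g A) \<or>
    (\<exists>y\<in>F - {x}. secures W False (copy g (F - {x} - {y})) (copy g (insert y A)))"
proof (cases "\<exists>z. x = Inr (g, z)")
  case True
  then obtain z where z: "x = Inr (g, z)" by blast
  then have "z \<in> copy g F" using \<open>x \<in> F\<close> by simp
  from secures_reply[OF s this] show ?thesis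
  proof
    assume "\<exists>y\<in>copy g F - {z}. secures W False (copy g F - {z} - {y}) (insert y (copy g A))"
    then obtain y where "y \<in> copy g F - {z}"
      "secures W False (copy g F - {z} - {y}) (insert y (copy g A))" by blast
    then show ?thesis
      using z by (intro disjI2 bexI[of _ "Inr (g, y)"]) simp_all
  qed (use z in simp)
next
  case False
  then have "copy g (F - {x}) = copy g F" by auto
  with s show ?thesis by simp
qed

section \<open>Winning sets of the corona in terms of single copies\<close>

lemma finite_pverts_corona:
  "finite (pverts G) \<Longrightarrow> finite (pverts H) \<Longrightarrow> finite (pverts (G \<odot> H))"
  by (simp add: corona_def)

lemma copy_pverts_corona [simp]: "g \<in> pverts G \<Longrightarrow> copy g (pverts (G \<odot> H)) = pverts H"
  by (auto simp: copy_def corona_def)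

lemma Inl_in_pverts_corona [simp]: "Inl g \<in> pverts (G \<odot> H) \<longleftrightarrow> g \<in> pverts G"
  by (auto simp: corona_def)

lemma winning_set_corona_Dominator:
  assumes "pverts H \<noteq> {}"
    and local: "\<And>g. g \<in> pverts G \<Longrightarrow> Inl g \<in> A \<or> winning_set H Dominator (copy g A)"
  shows "winning_set (G \<odot> H) Dominator A"
proof -
  \<comment> \<open>\<open>A\<close> is arbitrary, whereas a dominating set must consist of
    vertices.\<close>
  let ?D = "A \<inter> pverts (G \<odot> H)"
  have "\<exists>u\<in>?D. (u, v) \<in> parcs (G \<odot> H)" if v: "v \<in> pverts (G \<odot> H) - ?D" for v
  proof -
    from v obtain g where g: "g \<in> pverts G" "v = Inl g \<or> (\<exists>x\<in>pverts H. v = Inr (g, x))"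
      by (auto simp: corona_def)
    show ?thesis
    proof (cases "Inl g \<in> A")
      case True
      then have "(Inl g, v) \<in> parcs (G \<odot> H)" "Inl g \<in> ?D"
        using g v by (auto simp: corona_def)
      then show ?thesis by blast
    next
      case False
      then obtain D where D: "dominating_set H D" "D \<subseteq> copy g A"
        using local g by auto
      then have sub: "Inr (g, x) \<in> ?D" if "x \<in> D" for x
        using that g by (auto simp: dominating_set_def corona_def)
      from g(2) show ?thesis
      proof
        assume "v = Inl g"
        \<comment> \<open>A dominating set of a graph with vertices is nonempty, and each of its
          members is adjacent to \<open>g\<close> in the corona.\<close>
        obtain x where "x \<in> D"
          using D(1) \<open>pverts H \<noteq> {}\<close> by (auto simp: dominating_set_def)
        moreover have "(Inr (g, x), Inl g) \<in> parcs (G \<odot> H)"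
          using \<open>x \<in> D\<close> D(1) g(1) by (auto simp: dominating_set_def corona_def)
        ultimately show ?thesis using sub \<open>v = Inl g\<close> by blast
      next
        assume "\<exists>x\<in>pverts H. v = Inr (g, x)"
        then obtain x where x: "x \<in> pverts H" "v = Inr (g, x)" by blast
        with v sub have "x \<notin> D" by blast
        with x D(1) obtain y where "y \<in> D" "(y, x) \<in> parcs H"
          by (auto simp: dominating_set_def)
        moreover from this have "(Inr (g, y), v) \<in> parcs (G \<odot> H)"
          using x g(1) by (auto simp: corona_def)
        ultimately show ?thesis using sub by blast
      qed
    qed
  qed
  then show ?thesis by (auto simp: dominating_set_def)
qed

text \<open>Outside its copy, a vertex of the copy at \<open>g\<close> is adjacent only to
  \<open>g\<close>. A dominating set without \<open>g\<close> therefore has to dominate the copy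
  from within.\<close>

lemma winning_set_corona_Staller:
  assumes "g \<in> pverts G" and "Inl g \<in> A" and "winning_set H Staller (copy g A)"
  shows "winning_set (G \<odot> H) Staller A"
proof -
  have "D \<inter> A \<noteq> {}" if D: "dominating_set (G \<odot> H) D" for D
  proof (cases "Inl g \<in> D")
    case True
    then show ?thesis using assms by blast
  next
    case False
    have "\<exists>u\<in>copy g D. (u, v) \<in> parcs H" if v: "v \<in> pverts H - copy g D" for v
    proof -
      have "Inr (g, v) \<in> pverts (G \<odot> H) - D"
        using v assms(1) by (auto simp: corona_def)
      then obtain u where "u \<in> D" "(u, Inr (g, v)) \<in> parcs (G \<odot> H)"
        using D by (auto simp: dominating_set_def)
      then show ?thesis using False by (auto simp: corona_def)
    qed
    then have "dominating_set H (copy g D)"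
      using D by (auto simp: dominating_set_def corona_def)
    then have "copy g D \<inter> copy g A \<noteq> {}" using assms by simp
    then show ?thesis by auto
  qed
  then show ?thesis by simp
qed

lemma secures_corona_Dominator:
  fixes G :: "'a pair_pre_digraph" and H :: "'b pair_pre_digraph"
  assumes fin: "finite (pverts G)" "finite (pverts H)" and "pverts H \<noteq> {}"
    and first: "secures (winning_set H Dominator) True (pverts H) {}"
  shows "secures (winning_set (G \<odot> H) Dominator) b (pverts (G \<odot> H)) {}"
proof -
  let ?W = "winning_set H Dominator"
  \<comment> \<open>Three stages at \<open>g\<close>: Dominator owns \<open>g\<close>; or
    \<open>g\<close> is free and he would win on the copy by moving first; or he wins on the copy
    even with Staller to move.\<close>
  define safe where "safe g F A \<longleftrightarrow> Inl g \<in> A \<or> (Inl g \<in> F \<and> secures ?W True (copy g F) (copy g A)) \<or>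
    secures ?W False (copy g F) (copy g A)" for g :: 'a and F A :: "('a + 'a \<times> 'b) set"
  have extra: "safe g (F - {x}) (insert x A)" if "finite F" "x \<in> F" "safe g F A" for g F A x
  proof -
    have *: "secures ?W c (copy g F) (copy g A) \<Longrightarrow>
        secures ?W c (copy g (F - {x})) (copy g (insert x A))" for c
      using that by (intro secures_copy_extra mono_winning_set)
    from \<open>safe g F A\<close> show ?thesis
      unfolding safe_def using *[of True] *[of False] by blast
  qed
  have reply: "safe g (F - {x}) A \<or>
      (\<exists>y\<in>F - {x}. safe g (F - {x} - {y}) (insert y A))"
    if "x \<in> F" "safe g F A" for g F A x
  proof -
    consider "Inl g \<in> A" | "Inl g \<in> F" "secures ?W True (copy g F) (copy g A)"
      | "secures ?W False (copy g F) (copy g A)"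
      using \<open>safe g F A\<close> unfolding safe_def by blast
    then show ?thesis
    proof cases
      case 1
      then show ?thesis by (simp add: safe_def)
    next
      case 2
      show ?thesis
      proof (cases "x = Inl g")
        case False
        then have "Inl g \<in> F - {x}" using 2 by simp
        moreover have "safe g (F - {x} - {Inl g}) (insert (Inl g) A)" by (simp add: safe_def)
        ultimately show ?thesis by blast
      next
        case x: True
        show ?thesis
        \<comment> \<open>On an exhausted copy it does not matter who is to move, so the third
          disjunct of \<open>safe\<close> already holds.\<close>
        proof (cases "copy g F = {}")
          case True
          then show ?thesis using 2 x by (simp add: safe_def)
        next
          case False
          then obtain y where y: "y \<in> copy g F"
            and s: "secures ?W False (copy g F - {y}) (insert y (copy g A))"
            using 2 by (auto simp: secures_True_iff simp del: mem_copy)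
          have "safe g (F - {x} - {Inr (g, y)}) (insert (Inr (g, y)) A)"
            using s x by (simp add: safe_def)
          moreover have "Inr (g, y) \<in> F - {x}" using x y by simp
          ultimately show ?thesis by blast
        qed
      qed
    next
      case 3
      from secures_copy_reply[OF \<open>x \<in> F\<close> 3] show ?thesis
        unfolding safe_def by blast
    qed
  qed
  have elsewhere: "safe g (F - {x}) A"
    if "x \<noteq> Inl g" "\<forall>z. x \<noteq> Inr (g, z)" "safe g F A" for g F A x
  proof -
    have "copy g (F - {x}) = copy g F" using that(2) by auto
    then show ?thesis using that by (auto simp: safe_def)
  qed
  show ?thesis
  proof (rule secures_by_invariant[where I = "\<lambda>F A. \<forall>g\<in>pverts G. safe g F A"])
    show "\<forall>g\<in>pverts G. safe g (pverts (G \<odot> H)) {}"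
      using first by (simp add: safe_def)
    show "winning_set (G \<odot> H) Dominator A" if "\<forall>g\<in>pverts G. safe g {} A" for A
      using that \<open>pverts H \<noteq> {}\<close>
      by (intro winning_set_corona_Dominator) (auto simp: safe_def simp del: winning_set.simps)
  next
    fix F :: "('a + 'a \<times> 'b) set" and A x
    assume F: "finite F" "x \<in> F" and I: "\<forall>g\<in>pverts G. safe g F A"
    then show "\<forall>g\<in>pverts G. safe g (F - {x}) (insert x A)"
      using extra by blast
    obtain u where u: "x = Inl u \<or> (\<exists>z. x = Inr (u, z))"
      by (metis old.sum.exhaust surj_pair)
    then have others: "safe g (F - {x}) A" if "g \<in> pverts G - {u}" for g
      using elsewhere[of x g F A] I that by auto
    show "(\<forall>g\<in>pverts G. safe g (F - {x}) A) \<or>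
        (\<exists>y\<in>F - {x}. \<forall>g\<in>pverts G. safe g (F - {x} - {y}) (insert y A))"
    \<comment> \<open>Dominator answers only if the move endangers its own part \<open>u\<close>;
      for all other parts the answer is an extra vertex. As \<open>F\<close> is arbitrary,
      \<open>u\<close> need not be a vertex of \<open>G\<close>.\<close>
    proof (cases "u \<in> pverts G \<and> \<not> safe u (F - {x}) A")
      case True
      then obtain y where y: "y \<in> F - {x}" "safe u (F - {x} - {y}) (insert y A)"
        using reply F I by blast
      then have "safe g (F - {x} - {y}) (insert y A)" if "g \<in> pverts G" for g
        using extra[of "F - {x}" y g A] others[of g] F that by (cases "g = u") auto
      with y show ?thesis by blast
    next
      case False
      with others show ?thesis by blast
    qed
  qed (rule finite_pverts_corona[OF fin])
qed

text \<open>Once Staller owns \<open>g\<close>, only play on its copy matters. \<open>F\<close> and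
  \<open>A\<close> are general so that the result applies after earlier moves elsewhere.\<close>

lemma secures_corona_Staller:
  fixes G :: "'a pair_pre_digraph" and H :: "'b pair_pre_digraph"
  assumes fin: "finite F" and g: "g \<in> pverts G"
    and "Inl g \<in> A" and "secures (winning_set H Staller) False (copy g F) (copy g A)"
  shows "secures (winning_set (G \<odot> H) Staller) b F A"
proof (rule secures_by_invariant[where
      I = "\<lambda>F A. Inl g \<in> A \<and> secures (winning_set H Staller) False (copy g F) (copy g A)"])
  fix F :: "('a + 'a \<times> 'b) set" and A x
  assume F: "finite F" "x \<in> F"
    and I: "Inl g \<in> A \<and> secures (winning_set H Staller) False (copy g F) (copy g A)"
  show "Inl g \<in> insert x A \<and>
      secures (winning_set H Staller) False (copy g (F - {x})) (copy g (insert x A))"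
    using I secures_copy_extra[OF mono_winning_set F] by blast
  show "(Inl g \<in> A \<and> secures (winning_set H Staller) False (copy g (F - {x})) (copy g A)) \<or>
      (\<exists>y\<in>F - {x}. Inl g \<in> insert y A \<and>
        secures (winning_set H Staller) False (copy g (F - {x} - {y})) (copy g (insert y A)))"
    using secures_copy_reply[OF F(2) conjunct2[OF I]] I by blast
next
  fix A :: "('a + 'a \<times> 'b) set"
  assume "Inl g \<in> A \<and> secures (winning_set H Staller) False (copy g {}) (copy g A)"
  then show "winning_set (G \<odot> H) Staller A"
    using winning_set_corona_Staller[OF g, of A H] by (simp del: winning_set.simps)
qed (use assms in blast)+

text \<open>\<open>pair_graph\<close> admits the graph without vertices. It has outcome
  \<open>Outcome_D\<close>, since the empty set dominates it, while the corona is then a mere copy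
  of \<open>G\<close>; hence the assumption on \<open>pverts H\<close>.\<close>

theorem theorem2p1:
  fixes G :: "'a pair_pre_digraph" and H :: "'b pair_pre_digraph"
  assumes "pair_graph G" and "connected G" and "card (pverts G) \<ge> 2"
    and "pair_graph H" and "pverts H \<noteq> {}"
  shows "(has_outcome H \<D> \<or> has_outcome H \<N> \<longrightarrow> has_outcome (G \<odot> H) \<D>)
    \<and> (has_outcome H \<S> \<longrightarrow> has_outcome (G \<odot> H) \<S>)"
proof -
  have fin: "finite (pverts G)" "finite (pverts H)"
    using assms by (auto intro: pair_fin_digraph.pair_finite_verts simp: pair_graph_def pair_pseudo_graph_def)
  note finC = finite_pverts_corona[OF fin]
  have D: "has_outcome (G \<odot> H) \<D>" if "has_outcome H \<D> \<or> has_outcome H \<N>"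
  proof -
    have "has_winning_strategy H Dominator Dominator"
      using that by auto
    then have "secures (winning_set H Dominator) True (pverts H) {}"
      using has_winning_strategy_iff_secures[OF fin(2), of Dominator Dominator] by simp
    then show ?thesis
      using secures_corona_Dominator[OF fin assms(5)] has_winning_strategy_iff_secures[OF finC]
      by simp
  qed
  have S: "has_outcome (G \<odot> H) \<S>" if "has_outcome H \<S>"
  proof -
    let ?V = "pverts (G \<odot> H)" and ?W = "winning_set (G \<odot> H) Staller"
    \<comment> \<open>Staller must win on \<open>H\<close> as second player, since selecting
      \<open>g\<close> hands the move to Dominator.\<close>
    have H: "secures (winning_set H Staller) False (pverts H) {}"
      using that has_winning_strategy_iff_secures[OF fin(2), of Dominator Staller] by simp
    \<comment> \<open>\<open>X\<close> holds the vertices already taken by Dominator: none in the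
      S-game, his first vertex in the D-game.\<close>
    have after: "secures ?W True (?V - X) {}" if "g \<in> pverts G" "Inl g \<notin> X" "copy g X = {}" for g X
    proof (rule own_move)
      show "Inl g \<in> ?V - X" using that by simp
      have "copy g (?V - X) = pverts H"
        using that by (auto simp: copy_def corona_def)
      then show "secures ?W False (?V - X - {Inl g}) (insert (Inl g) {})"
        using H that finC by (intro secures_corona_Staller) auto
    qed
    obtain g where g: "g \<in> pverts G" using assms(3) by fastforce
    have "secures ?W True (?V - {x}) {}" for x
    proof -
      obtain u where u: "x = Inl u \<or> (\<exists>z. x = Inr (u, z))"
        by (metis old.sum.exhaust surj_pair)
      have "\<not> pverts G \<subseteq> {u}"
        using assms(3) card_mono[of "{u}" "pverts G"] by auto
      then obtain g where "g \<in> pverts G" "g \<noteq> u" by blast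
      then show ?thesis using u by (intro after[of g]) auto
    qed
    moreover have "?V \<noteq> {}" using g by (auto simp: corona_def)
    ultimately have "secures ?W False ?V {}" by (simp add: other_move)
    moreover have "secures ?W True ?V {}"
      using after[OF g, of "{}"] by simp
    ultimately have "secures ?W b ?V {}" for b
      by (cases b) auto
    then show ?thesis
      using has_winning_strategy_iff_secures[OF finC] by simp
  qed
  from D S show ?thesis by blast
qed

end
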